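(* Let $(\mathbf X,d)$ be a complete length space and $\Omega$ an open set in $\mathbf X$. Assume that $f:\Omega\to\mathbb R$ is locally uniformly continuous and $f>0$ in $\Omega$. If $u$ is a Monge solution of $|\nabla u|=f$ in $\Omega$, then $u$ is a local c-solution of $|\nabla u|=f$ in $\Omega$.
   Context: "Locally" means in a sufficiently small open ball around each point of $\Omega$; $B_r(x)$ is the open $d$-ball. Monge solution: $u$ is locally Lipschitz in $\Omega$ and $|\nabla^-u|(x)=f(x)$ for every $x\in\Omega$, where $|\nabla^-u|(x)=\limsup_{y\to x}\frac{\max\{u(x)-u(y),0\}}{d(x,y)}$. Admissible curves: $\mathcal A_x(\mathbb R,Y)$ is the set of absolutely continuous curves $\xi:\mathbb R\to Y\subset\mathbf X$ with $|\xi'|\le1$ a.e. (i.e. $1$-Lipschitz) and $\xi(0)=x$. For open $\mathcal O$, $T^+_{\mathcal O}[\xi]=\inf\{t\ge0:\xi(t)\notin\mathcal O\}$, $T^-_{\mathcal O}[\xi]=\sup\{t\le0:\xi(t)\notin\mathcal O\}$ ($\inf\emptyset=+\infty$, $\sup\emptyset=-\infty$). c-subsolution: an upper semicontinuous $u:\Omega\to\mathbb R$ such that for all $x\in\Omega$, $\xi\in\mathcal A_x(\mathbb R,\Omega)$ one has $|\phi'(0)|\le f(x)$ whenever $\phi\in C^1(\mathbb R)$ and $t\mapsto u(\xi(t))-\phi(t)$ has a local maximum at $t=0$. Local c-supersolution: a lower semicontinuous $u:\Omega\to\mathbb R$ such that for each $x\in\Omega$ there is $r>0$ with $B_r(x)\subset\Omega$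 such that for each $\varepsilon>0$ there are $\xi_\varepsilon\in\mathcal A_x(\mathbb R,\mathbf X)$ and a lower semicontinuous $w:(t_r^-,t_r^+)\to\mathbb R$, where $t_r^\pm=T^\pm_{B_r(x)}[\xi_\varepsilon]$, with $w(0)=u(x)$, $w(t)\ge u(\xi_\varepsilon(t))-\varepsilon$ for all $t\in(t_r^-,t_r^+)$, and $|\phi'(t_0)|\ge f(\xi_\varepsilon(t_0))-\varepsilon$ whenever $\phi\in C^1(\mathbb R)$ and $w-\phi$ attains a minimum at $t_0\in(t_r^-,t_r^+)$. Local c-solution: a continuous function that is both a c-subsolution and a local c-supersolution. *)

theory Defs
  imports "HOL-Analysis.Analysis"
begin

(* Metric length of a curve over the parameter interval [a, b]: the supremum, over all finite
   increasing lists of parameters, of the length of the inscribed polygon; possibly infinite. *)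
definition curve_length :: "(real \<Rightarrow> 'a::metric_space) \<Rightarrow> real \<Rightarrow> real \<Rightarrow> ereal" where
  "curve_length \<gamma> a b =
     (SUP ts \<in> {ts. sorted ts \<and> set ts \<subseteq> {a..b}}.
        ereal (\<Sum>i<length ts - 1. dist (\<gamma> (ts ! i)) (\<gamma> (ts ! Suc i))))"

(* Non-rectifiable curves do not affect the infimum, and the infimum over no curves is infinite,
   so any two points of a length space are joined by a rectifiable curve. *)
definition length_space :: "'a::metric_space itself \<Rightarrow> bool" where
  "length_space _ \<longleftrightarrow>
     (\<forall>x y :: 'a. ereal (dist x y) =
        (INF \<gamma> \<in> {\<gamma>. path \<gamma> \<and> pathstart \<gamma> = x \<and> pathfinish \<gamma> = y}. curve_length \<gamma> 0 1))"

(* Functions on an open set are total functions of which only the values on that set are used. *)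

definition locally_uniformly_continuous_on ::
    "'a::metric_space set \<Rightarrow> ('a \<Rightarrow> real) \<Rightarrow> bool" where
  "locally_uniformly_continuous_on \<Omega> f \<longleftrightarrow>
     (\<forall>x\<in>\<Omega>. \<exists>r>0. ball x r \<subseteq> \<Omega> \<and> uniformly_continuous_on (ball x r) f)"

definition locally_lipschitz_on :: "'a::metric_space set \<Rightarrow> ('a \<Rightarrow> real) \<Rightarrow> bool" where
  "locally_lipschitz_on \<Omega> u \<longleftrightarrow>
     (\<forall>x\<in>\<Omega>. \<exists>r>0. ball x r \<subseteq> \<Omega> \<and> (\<exists>L. L-lipschitz_on (ball x r) u))"

definition usc_on :: "'a::topological_space set \<Rightarrow> ('a \<Rightarrow> real) \<Rightarrow> bool" where
  "usc_on S u \<longleftrightarrow> (\<forall>x\<in>S. \<forall>a>u x. \<forall>\<^sub>F y in at x within S. u y < a)"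

definition lsc_on :: "'a::topological_space set \<Rightarrow> ('a \<Rightarrow> real) \<Rightarrow> bool" where
  "lsc_on S u \<longleftrightarrow> (\<forall>x\<in>S. \<forall>a<u x. \<forall>\<^sub>F y in at x within S. a < u y)"

(* The value at an isolated point of the domain is minus infinity (limit superior along the
   trivial filter). *)
definition subslope :: "'a::metric_space set \<Rightarrow> ('a \<Rightarrow> real) \<Rightarrow> 'a \<Rightarrow> ereal" where
  "subslope \<Omega> u x =
     Limsup (at x within \<Omega>) (\<lambda>y. ereal (max (u x - u y) 0 / dist x y))"

definition monge_solution ::
    "'a::metric_space set \<Rightarrow> ('a \<Rightarrow> real) \<Rightarrow> ('a \<Rightarrow> real) \<Rightarrow> bool" where
  "monge_solution \<Omega> f u \<longleftrightarrow>
     locally_lipschitz_on \<Omega> u \<and> (\<forall>x\<in>\<Omega>. subslope \<Omega> u x = ereal (f x))"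

(* Absolutely continuous curves with metric speed at most 1 almost everywhere are exactly the
   1-Lipschitz ones. *)
definition admissible_curves :: "'a::metric_space \<Rightarrow> 'a set \<Rightarrow> (real \<Rightarrow> 'a) set" where
  "admissible_curves x Y = {\<xi>. 1-lipschitz_on UNIV \<xi> \<and> range \<xi> \<subseteq> Y \<and> \<xi> 0 = x}"

definition exit_time_plus :: "'a set \<Rightarrow> (real \<Rightarrow> 'a) \<Rightarrow> ereal" where
  "exit_time_plus U \<xi> = Inf {ereal t |t. 0 \<le> t \<and> \<xi> t \<notin> U}"

definition exit_time_minus :: "'a set \<Rightarrow> (real \<Rightarrow> 'a) \<Rightarrow> ereal" where
  "exit_time_minus U \<xi> = Sup {ereal t |t. t \<le> 0 \<and> \<xi> t \<notin> U}"

definition exit_interval :: "'a set \<Rightarrow> (real \<Rightarrow> 'a) \<Rightarrow> real set" where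
  "exit_interval U \<xi> =
     {t. exit_time_minus U \<xi> < ereal t \<and> ereal t < exit_time_plus U \<xi>}"

definition c_subsolution ::
    "'a::metric_space set \<Rightarrow> ('a \<Rightarrow> real) \<Rightarrow> ('a \<Rightarrow> real) \<Rightarrow> bool" where
  "c_subsolution \<Omega> f u \<longleftrightarrow>
     usc_on \<Omega> u \<and>
     (\<forall>x\<in>\<Omega>. \<forall>\<xi>\<in>admissible_curves x \<Omega>. \<forall>\<phi>.
        \<phi> C1_differentiable_on UNIV \<longrightarrow>
        (\<forall>\<^sub>F t in nhds 0. u (\<xi> t) - \<phi> t \<le> u (\<xi> 0) - \<phi> 0) \<longrightarrow>
        \<bar>deriv \<phi> 0\<bar> \<le> f x)"

(* The minimum in the test condition is taken over the whole interval on which w is defined. *)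
definition local_c_supersolution ::
    "'a::metric_space set \<Rightarrow> ('a \<Rightarrow> real) \<Rightarrow> ('a \<Rightarrow> real) \<Rightarrow> bool" where
  "local_c_supersolution \<Omega> f u \<longleftrightarrow>
     lsc_on \<Omega> u \<and>
     (\<forall>x\<in>\<Omega>. \<exists>r>0. ball x r \<subseteq> \<Omega> \<and>
        (\<forall>\<epsilon>>0. \<exists>\<xi>\<in>admissible_curves x UNIV. \<exists>w :: real \<Rightarrow> real.
           let I = exit_interval (ball x r) \<xi> in
             lsc_on I w \<and>
             w 0 = u x \<and>
             (\<forall>t\<in>I. u (\<xi> t) - \<epsilon> \<le> w t) \<and>
             (\<forall>\<phi>. \<phi> C1_differentiable_on UNIV \<longrightarrow>
                (\<forall>t\<^sub>0\<in>I. (\<forall>t\<in>I. w t\<^sub>0 - \<phi> t\<^sub>0 \<le> w t - \<phi> t) \<longrightarrow>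
                   f (\<xi> t\<^sub>0) - \<epsilon> \<le> \<bar>deriv \<phi> t\<^sub>0\<bar>))))"

definition local_c_solution ::
    "'a::metric_space set \<Rightarrow> ('a \<Rightarrow> real) \<Rightarrow> ('a \<Rightarrow> real) \<Rightarrow> bool" where
  "local_c_solution \<Omega> f u \<longleftrightarrow>
     continuous_on \<Omega> u \<and> c_subsolution \<Omega> f u \<and> local_c_supersolution \<Omega> f u"

end

theory Submission
  imports Defs
begin

text \<open>
  Subsolution: along a 1-Lipschitz curve \<open>\<xi>\<close> from \<open>x\<close>, the decrease of \<open>u\<close> is at most
  \<open>(f x + e) * |t|\<close> near \<open>t = 0\<close>, on both sides, which bounds the derivative of a test function.

  Supersolution: if the descending slope of \<open>u\<close> exceeds \<open>k > 0\<close> on a closed ball of radius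
  \<open>\<rho>\<close>, the Ekeland variational principle gives a point on its boundary sphere where \<open>u\<close> has
  dropped by at least \<open>k * \<rho>\<close>, since an interior Ekeland point would have slope at most \<open>k\<close>.
  Iterating with a fixed small radius yields a sequence along which \<open>u\<close> decreases at rate almost
  \<open>f\<close>; the length structure joins consecutive points by 1-Lipschitz curves run in equal times
  \<open>\<tau>\<close> slightly above \<open>\<rho>\<close>, and the curve is extended evenly to negative times.
\<close>

section \<open>Ekeland's principle and descent to a sphere\<close>

text \<open>Being reachable by descent at rate \<open>k\<close> is a transitive relation, so one can
  pass repeatedly to near-minimisers of \<open>u\<close> among the points still reachable. Distances
  are paid for by drops of \<open>u\<close>, which makes the sequence Cauchy; from its limit no
  other point is reachable.\<close>

lemma ekeland_point:
  fixes u :: "'a::metric_space \<Rightarrow> real"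
  assumes S: "complete S" and cont: "continuous_on S u" and bdd: "bdd_below (u ` S)"
    and k: "k > 0" and y: "y \<in> S"
  obtains z where "z \<in> S" "u z + k * dist y z \<le> u y"
    "\<And>v. v \<in> S \<Longrightarrow> v \<noteq> z \<Longrightarrow> u z < u v + k * dist z v"
proof -
  define T where "T z = {v \<in> S. u v + k * dist z v \<le> u z}" for z
  have T_trans: "c \<in> T a" if "b \<in> T a" "c \<in> T b" for a b c
  proof -
    have "k * dist a c \<le> k * (dist a b + dist b c)"
      using k dist_triangle[of a c b] by simp
    with that show ?thesis by (simp add: T_def distrib_left)
  qed
  have T_bdd: "bdd_below (u ` T z)" for z
    by (rule bdd_below_mono[OF bdd]) (auto simp: T_def)
  \<comment> \<open>A minimiser on \<open>T a\<close> may not exist; the slack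
    \<open>(1/2)^n\<close> vanishes along the sequence.\<close>
  have next_ex: "\<exists>b. b \<in> T a \<and> (\<forall>c\<in>T a. u b \<le> u c + (1/2)^n)" if "a \<in> S" for a and n :: nat
  proof -
    have ne: "u ` T a \<noteq> {}" using that by (auto simp: T_def)
    have "Inf (u ` T a) < Inf (u ` T a) + (1/2)^n" by simp
    then obtain b where b: "b \<in> T a" "u b < Inf (u ` T a) + (1/2)^n"
      using cInf_lessD[OF ne] by blast
    moreover have "Inf (u ` T a) \<le> u c" if "c \<in> T a" for c
      using T_bdd that by (auto intro: cInf_lower)
    ultimately show ?thesis by force
  qed
  have "\<exists>z. z 0 = y \<and> (\<forall>n. z n \<in> S \<and> z (Suc n) \<in> T (z n) \<and>
          (\<forall>c\<in>T (z n). u (z (Suc n)) \<le> u c + (1/2)^n))"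
  proof -
    define g where "g n a = (SOME b. b \<in> T a \<and> (\<forall>c\<in>T a. u b \<le> u c + (1/2)^n))" for n a
    have g: "g n a \<in> T a \<and> (\<forall>c\<in>T a. u (g n a) \<le> u c + (1/2)^n)" if "a \<in> S" for n a
      unfolding g_def by (rule someI_ex, rule next_ex, rule that)
    define z where "z = rec_nat y (\<lambda>n a. g n a)"
    have z: "z 0 = y" "z (Suc n) = g n (z n)" for n by (simp_all add: z_def)
    have zS: "z n \<in> S" for n
      by (induction n) (use y z g in \<open>auto simp: T_def\<close>)
    show ?thesis using z zS g by (intro exI[of _ z]) auto
  qed
  then obtain z where z0: "z 0 = y" and zS: "\<And>n. z n \<in> S" and zT: "\<And>n. z (Suc n) \<in> T (z n)"
    and zmin: "\<And>n c. c \<in> T (z n) \<Longrightarrow> u (z (Suc n)) \<le> u c + (1/2)^n" by blast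
  have zT': "z m \<in> T (z n)" if "n \<le> m" for n m
    using that
  proof (induction rule: dec_induct)
    case base then show ?case using zS by (simp add: T_def)
  next
    case (step m) then show ?case using T_trans zT by blast
  qed
  have dec: "decseq (\<lambda>n. u (z n))"
  proof (rule decseq_SucI)
    fix n
    have "u (z (Suc n)) + k * dist (z n) (z (Suc n)) \<le> u (z n)" using zT[of n] by (simp add: T_def)
    moreover have "0 \<le> k * dist (z n) (z (Suc n))" using k by simp
    ultimately show "u (z (Suc n)) \<le> u (z n)" by linarith
  qed
  obtain B where B: "\<And>v. v \<in> S \<Longrightarrow> B \<le> u v" using bdd by (auto simp: bdd_below_def)
  obtain l where l: "(\<lambda>n. u (z n)) \<longlonglongrightarrow> l"
    using decseq_convergent[OF dec] B[OF zS] by metis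
  have "Cauchy (\<lambda>n. u (z n))" using l by (rule LIMSEQ_imp_Cauchy)
  have "Cauchy z"
  proof (rule metric_CauchyI)
    fix e :: real assume "e > 0"
    then obtain N where N: "\<And>m n. m \<ge> N \<Longrightarrow> n \<ge> N \<Longrightarrow> dist (u (z m)) (u (z n)) < k * e"
      using \<open>Cauchy (\<lambda>n. u (z n))\<close> k by (metis Cauchy_def mult_pos_pos)
    have *: "dist (z n) (z m) < e" if "n \<ge> N" "n \<le> m" for n m
    proof -
      have "k * dist (z n) (z m) \<le> u (z n) - u (z m)" using zT'[OF that(2)] by (simp add: T_def)
      also have "\<dots> < k * e" using N[of n m] that by (auto simp: dist_real_def)
      finally show ?thesis using k by simp
    qed
    show "\<exists>M. \<forall>m\<ge>M. \<forall>n\<ge>M. dist (z m) (z n) < e"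
      using * by (metis dist_commute nle_le)
  qed
  then obtain p where p: "p \<in> S" "z \<longlonglongrightarrow> p" using S zS by (metis complete_def)
  have up: "(\<lambda>n. u (z n)) \<longlonglongrightarrow> u p"
    using cont p zS by (auto intro: continuous_on_tendsto_compose)
  have pT: "p \<in> T (z n)" for n
  proof -
    have "(\<lambda>m. u (z m) + k * dist (z n) (z m)) \<longlonglongrightarrow> u p + k * dist (z n) p"
      by (intro tendsto_intros up p)
    then have "u p + k * dist (z n) p \<le> u (z n)"
      by (rule LIMSEQ_le_const2) (use zT'[of n] in \<open>auto simp: T_def\<close>)
    then show ?thesis using p by (simp add: T_def)
  qed
  show ?thesis
  proof
    show "p \<in> S" by fact
    show "u p + k * dist y p \<le> u y" using pT[of 0] z0 by (simp add: T_def)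
    fix v assume v: "v \<in> S" "v \<noteq> p"
    show "u p < u v + k * dist p v"
    proof (rule ccontr)
      assume "\<not> ?thesis"
      \<comment> \<open>A competitor \<open>v\<close> in \<open>T p\<close> lies in every
        \<open>T (z n)\<close>, so near-minimality gives \<open>u p \<le> u v\<close> in the limit,
        against the positive cost \<open>k * dist p v\<close>.\<close>
      then have vT: "v \<in> T p" using v by (simp add: T_def)
      have "(\<lambda>n. u v + (1/2)^n) \<longlonglongrightarrow> u v + 0"
        by (intro tendsto_intros LIMSEQ_power_zero) simp
      then have "u p \<le> u v + 0"
        using LIMSEQ_Suc[OF up] zmin T_trans[OF pT vT]
        by (intro LIMSEQ_le[of _ "u p"]) auto
      moreover have "0 < k * dist p v" using k v by simp
      ultimately show False using vT by (simp add: T_def)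
    qed
  qed
qed

lemma subslope_descent:
  assumes "ereal k < subslope \<Omega> u z" "0 \<le> k" "0 < \<delta>"
  obtains v where "v \<in> \<Omega>" "v \<noteq> z" "dist z v < \<delta>" "u v + k * dist z v < u z"
proof -
  have "\<not> (\<forall>\<^sub>F v in at z within \<Omega>. ereal (max (u z - u v) 0 / dist z v) \<le> ereal k)"
  proof
    assume "\<forall>\<^sub>F v in at z within \<Omega>. ereal (max (u z - u v) 0 / dist z v) \<le> ereal k"
    then have "subslope \<Omega> u z \<le> ereal k" unfolding subslope_def by (rule Limsup_bounded)
    with assms(1) show False by simp
  qed
  then obtain v where v: "v \<in> \<Omega>" "v \<noteq> z" "dist v z < \<delta>"
      "\<not> ereal (max (u z - u v) 0 / dist z v) \<le> ereal k"
    unfolding eventually_at using assms(3) by blast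
  then have "k < max (u z - u v) 0 / dist z v" by simp
  then have "k * dist z v < max (u z - u v) 0"
    using v(2) by (subst (asm) pos_less_divide_eq) auto
  moreover have "0 \<le> k * dist z v" using assms by simp
  ultimately have "u v + k * dist z v < u z" by linarith
  with v show ?thesis by (intro that) (auto simp: dist_commute)
qed

text \<open>Closed balls need not be compact, hence an Ekeland point in place of a minimiser; the
  Lipschitz bound supplies the lower bound on \<open>u\<close>. An Ekeland point off the sphere
  would leave room in the ball for a descent step at rate \<open>k\<close>, which its strict
  inequality forbids.\<close>

lemma slope_sphere_descent:
  fixes u :: "'a::complete_space \<Rightarrow> real"
  assumes lip: "L-lipschitz_on (cball y \<rho>) u"
    and k: "k > 0" and \<rho>: "\<rho> > 0"
    and slope: "\<And>z. z \<in> cball y \<rho> \<Longrightarrow> ereal k < subslope \<Omega> u z"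
  obtains z where "dist y z = \<rho>" "u z \<le> u y - k * \<rho>"
proof -
  have "complete (cball y \<rho>)" by (simp add: complete_eq_closed)
  moreover have "continuous_on (cball y \<rho>) u" using lip by (rule lipschitz_on_continuous_on)
  moreover have "bdd_below (u ` cball y \<rho>)"
  proof (rule bdd_belowI2)
    fix v assume v: "v \<in> cball y \<rho>"
    have "dist (u y) (u v) \<le> L * dist y v"
      using lipschitz_onD[OF lip] v \<rho> by auto
    also have "\<dots> \<le> L * \<rho>" using v lipschitz_on_nonneg[OF lip] by (intro mult_left_mono) auto
    finally show "u y - L * \<rho> \<le> u v" by (simp add: dist_real_def)
  qed
  ultimately obtain z where z: "z \<in> cball y \<rho>" "u z + k * dist y z \<le> u y"
    "\<And>v. v \<in> cball y \<rho> \<Longrightarrow> v \<noteq> z \<Longrightarrow> u z < u v + k * dist z v"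
    using ekeland_point[of "cball y \<rho>" u k y] k \<rho> by (metis centre_in_cball less_imp_le)
  have "dist y z = \<rho>"
  proof (rule ccontr)
    assume "dist y z \<noteq> \<rho>"
    then have "0 < \<rho> - dist y z" using z(1) by auto
    from subslope_descent[OF slope[OF z(1)] _ this] k
    obtain v where v: "v \<noteq> z" "dist z v < \<rho> - dist y z" "u v + k * dist z v < u z"
      by auto
    moreover have "v \<in> cball y \<rho>" using v(2) dist_triangle[of y v z] by simp
    ultimately show False using z(3) by fastforce
  qed
  with z(2) that show ?thesis by auto
qed

section \<open>One-sided derivative tests and the subsolution property\<close>

text \<open>In the applications \<open>s\<close> is \<open>1\<close> or \<open>-1\<close> and
  selects the side of \<open>t\<close>; the chain rule reduces both sides to quotients in
  \<open>h\<close> from the right.\<close>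

lemma has_real_derivative_one_sided_le:
  fixes \<phi> :: "real \<Rightarrow> real"
  assumes D: "(\<phi> has_real_derivative D) (at t)"
    and le: "\<forall>\<^sub>F h in at_right 0. \<phi> (t + s * h) - \<phi> t \<le> c * h"
  shows "s * D \<le> c"
proof -
  have "((\<lambda>h. \<phi> (t + s * h)) has_real_derivative D * s) (at 0)"
    by (rule DERIV_chain2[where f = \<phi>]) (use D in \<open>auto intro!: derivative_eq_intros\<close>)
  then have "((\<lambda>h. (\<phi> (t + s * h) - \<phi> t) / h) \<longlongrightarrow> D * s) (at 0)"
    by (simp add: DERIV_def)
  then have "((\<lambda>h. (\<phi> (t + s * h) - \<phi> t) / h) \<longlongrightarrow> D * s) (at_right 0)"
    by (rule tendsto_within_subset) simp
  moreover have "\<forall>\<^sub>F h in at_right 0. (\<phi> (t + s * h) - \<phi> t) / h \<le> c"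
    using le eventually_at_right_less[of 0]
    by eventually_elim (simp add: field_simps)
  ultimately have "D * s \<le> c" by (rule tendsto_upperbound) simp
  then show ?thesis by (simp add: mult.commute)
qed

text \<open>\<open>C1_differentiable_on\<close> provides some vector derivative, whereas the test
  conditions speak of \<open>deriv\<close>.\<close>

lemma C1_differentiable_on_imp_DERIV:
  fixes \<phi> :: "real \<Rightarrow> real"
  assumes "\<phi> C1_differentiable_on UNIV"
  shows "(\<phi> has_real_derivative deriv \<phi> t) (at t)"
proof -
  obtain D where "(\<phi> has_vector_derivative D t) (at t)"
    using assms by (auto simp: C1_differentiable_on_def)
  then have "(\<phi> has_real_derivative D t) (at t)"
    by (simp add: has_real_derivative_iff_has_vector_derivative)
  then show ?thesis using DERIV_imp_deriv by metis
qed

lemma monge_solution_c_subsolution: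
  assumes pos: "\<forall>x\<in>\<Omega>. f x > 0" and u: "monge_solution \<Omega> f u"
    and cont: "continuous_on \<Omega> u"
  shows "c_subsolution \<Omega> f u"
  unfolding c_subsolution_def
proof (intro conjI ballI allI impI)
  show "usc_on \<Omega> u"
    using cont by (auto simp: usc_on_def continuous_on_def order_tendstoD)
next
  fix x \<xi> \<phi> assume x: "x \<in> \<Omega>" and \<xi>: "\<xi> \<in> admissible_curves x \<Omega>"
    and \<phi>: "\<phi> C1_differentiable_on UNIV"
    and mx: "\<forall>\<^sub>F t in nhds 0. u (\<xi> t) - \<phi> t \<le> u (\<xi> 0) - \<phi> 0"
  have lip: "1-lipschitz_on UNIV \<xi>" and \<xi>0: "\<xi> 0 = x" and \<xi>\<Omega>: "\<xi> t \<in> \<Omega>" for t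
    using \<xi> by (auto simp: admissible_curves_def)
  show "\<bar>deriv \<phi> 0\<bar> \<le> f x"
  proof (rule field_le_epsilon)
    fix e :: real assume e: "e > 0"
    have "subslope \<Omega> u x < ereal (f x + e)"
      using u x e by (simp add: monge_solution_def)
    then have "\<forall>\<^sub>F y in at x within \<Omega>. ereal (max (u x - u y) 0 / dist x y) < ereal (f x + e)"
      unfolding subslope_def by (rule Limsup_lessD)
    then obtain d where d: "d > 0" "\<And>y. y \<in> \<Omega> \<Longrightarrow> y \<noteq> x \<Longrightarrow> dist y x < d \<Longrightarrow>
        max (u x - u y) 0 / dist x y < f x + e"
      unfolding eventually_at by auto
    have fe: "f x + e > 0" using pos x e by (simp add: add_pos_pos)
    have up: "u x - u y \<le> (f x + e) * dist x y" if "y \<in> \<Omega>" "dist y x < d" for y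
    proof (cases "y = x")
      case False
      then have "max (u x - u y) 0 < (f x + e) * dist x y"
        using d(2)[OF that(1) False that(2)] by (simp add: divide_less_eq)
      then show ?thesis by simp
    qed simp
    \<comment> \<open>The maximum condition bounds the increment of \<open>- \<phi>\<close> by the
      decrease of \<open>u\<close> along the curve. Taking \<open>s\<close> as \<open>1\<close> and
      \<open>-1\<close> then gives both halves of the bound on the absolute value.\<close>
    have ev: "\<forall>\<^sub>F h in at_right 0. - \<phi> (0 + s * h) - - \<phi> 0 \<le> (f x + e) * h" if s: "\<bar>s\<bar> = 1" for s
    proof -
      obtain d' where d': "d' > 0" "\<And>t. \<bar>t\<bar> < d' \<Longrightarrow> u (\<xi> t) - \<phi> t \<le> u (\<xi> 0) - \<phi> 0"
        using mx by (auto simp: eventually_nhds_metric dist_real_def)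
      have "\<forall>\<^sub>F h in at_right 0. h \<in> {0<..<min d d'}"
        using d(1) d'(1) by (intro eventually_at_right_real) auto
      then show ?thesis
      proof eventually_elim
        case (elim h)
        have "dist (\<xi> (s * h)) (\<xi> 0) \<le> 1 * dist (s * h) 0" by (rule lipschitz_onD[OF lip]) auto
        then have dh: "dist (\<xi> (s * h)) x \<le> h"
          using elim s by (simp add: dist_real_def abs_mult \<xi>0)
        then have "u x - u (\<xi> (s * h)) \<le> (f x + e) * dist x (\<xi> (s * h))"
          using elim by (intro up \<xi>\<Omega>) auto
        also have "\<dots> \<le> (f x + e) * h"
          using dh fe by (intro mult_left_mono) (auto simp: dist_commute)
        finally show ?case
          using d'(2)[of "s * h"] elim s by (simp add: abs_mult \<xi>0)
      qed
    qed
    have "((\<lambda>t. - \<phi> t) has_real_derivative - deriv \<phi> 0) (at 0)"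
      by (intro derivative_intros C1_differentiable_on_imp_DERIV \<phi>)
    from has_real_derivative_one_sided_le[OF this ev[of 1]]
      has_real_derivative_one_sided_le[OF this ev[of "-1"]]
    show "\<bar>deriv \<phi> 0\<bar> \<le> f x + e" by simp
  qed
qed

section \<open>Curve length and 1-Lipschitz connections in a length space\<close>

lemma chord_sum_snoc:
  fixes \<gamma> :: "real \<Rightarrow> 'a::metric_space"
  assumes "ts \<noteq> []"
  shows "(\<Sum>i<length (ts @ [t]) - 1. dist (\<gamma> ((ts @ [t]) ! i)) (\<gamma> ((ts @ [t]) ! Suc i)))
       = (\<Sum>i<length ts - 1. dist (\<gamma> (ts ! i)) (\<gamma> (ts ! Suc i))) + dist (\<gamma> (last ts)) (\<gamma> t)"
proof -
  obtain n where n: "length ts = Suc n" using assms by (cases ts) auto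
  then have "last ts = ts ! n" using assms by (simp add: last_conv_nth)
  then show ?thesis using n by (simp add: nth_append)
qed

lemma curve_length_nonneg: "0 \<le> curve_length \<gamma> a b"
  unfolding curve_length_def by (rule SUP_upper2[of "[]"]) auto

text \<open>Any list of nodes in \<open>{a..s}\<close> can be followed by \<open>s\<close> and
  \<open>t\<close>: appending \<open>s\<close> does not shorten the polygon, and the last chord adds
  \<open>dist (\<gamma> s) (\<gamma> t)\<close>. Thus increments of the length function dominate
  chords, as reparametrisation requires.\<close>

lemma curve_length_superadditive:
  fixes \<gamma> :: "real \<Rightarrow> 'a::metric_space"
  assumes "a \<le> s" "s \<le> t"
  shows "curve_length \<gamma> a s + ereal (dist (\<gamma> s) (\<gamma> t)) \<le> curve_length \<gamma> a t"
proof -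
  define P where "P ts = (\<Sum>i<length ts - 1. dist (\<gamma> (ts ! i)) (\<gamma> (ts ! Suc i)))" for ts
  have snoc: "P (ts @ [v]) = P ts + dist (\<gamma> (last ts)) (\<gamma> v)" if "ts \<noteq> []" for ts v
    unfolding P_def by (rule chord_sum_snoc[OF that])
  have "ereal (P ts) \<le> curve_length \<gamma> a t - ereal (dist (\<gamma> s) (\<gamma> t))"
    if ts: "sorted ts" "set ts \<subseteq> {a..s}" for ts
  proof -
    have "P ts \<le> P (ts @ [s])"
      using snoc[of ts s] by (cases "ts = []") (auto simp: P_def)
    moreover have "P (ts @ [s, t]) = P (ts @ [s]) + dist (\<gamma> s) (\<gamma> t)"
      using snoc[of "ts @ [s]" t] by simp
    moreover have "ereal (P (ts @ [s, t])) \<le> curve_length \<gamma> a t"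
      unfolding curve_length_def P_def
      by (rule SUP_upper) (use ts assms in \<open>force simp: sorted_append\<close>)
    ultimately have "ereal (P ts + dist (\<gamma> s) (\<gamma> t)) \<le> curve_length \<gamma> a t"
      by (metis add_right_mono ereal_less_eq(3) order_trans)
    then show ?thesis by (cases "curve_length \<gamma> a t") auto
  qed
  then have "curve_length \<gamma> a s \<le> curve_length \<gamma> a t - ereal (dist (\<gamma> s) (\<gamma> t))"
    unfolding curve_length_def[of _ a s] P_def by (intro SUP_least) auto
  then show ?thesis
    by (cases "curve_length \<gamma> a t"; cases "curve_length \<gamma> a s") auto
qed

text \<open>The length function need not be known to be continuous: over a jump of \<open>len\<close> the
  reparametrised curve simply rests.\<close>

lemma lipschitz_reparametrization:
  fixes \<gamma> :: "real \<Rightarrow> 'a::metric_space"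
  assumes cont: "continuous_on {0..1} \<gamma>"
    and chord: "\<And>s t. 0 \<le> s \<Longrightarrow> s \<le> t \<Longrightarrow> t \<le> 1 \<Longrightarrow> dist (\<gamma> s) (\<gamma> t) \<le> len t - len s"
    and len: "0 \<le> len 0" "len 1 \<le> \<tau>"
  obtains g where "1-lipschitz_on {0..\<tau>} g" "g 0 = \<gamma> 0" "g \<tau> = \<gamma> 1"
proof -
  have mono: "len s \<le> len t" if "0 \<le> s" "s \<le> t" "t \<le> 1" for s t
    using chord[OF that] zero_le_dist[of "\<gamma> s" "\<gamma> t"] by linarith
  have pos: "0 \<le> len s" if "0 \<le> s" "s \<le> 1" for s
    using mono[of 0 s] that len by linarith
  \<comment> \<open>\<open>\<sigma>\<close> is a generalised inverse of \<open>len\<close>;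
    inserting \<open>0\<close> keeps the supremum meaningful when no parameter satisfies
    \<open>len s \<le> t\<close>.\<close>
  define A where "A t = insert 0 {s \<in> {0..1}. len s \<le> t}" for t
  define \<sigma> where "\<sigma> t = Sup (A t)" for t
  have A: "A t \<noteq> {}" "bdd_above (A t)" "A t \<subseteq> {0..1}" for t
    unfolding A_def by (auto intro!: bdd_aboveI[of _ 1])
  have \<sigma>01: "0 \<le> \<sigma> t" "\<sigma> t \<le> 1" for t
    unfolding \<sigma>_def using A[of t]
    by (auto intro!: cSup_upper cSup_least simp: A_def)
  have low: "len s \<le> t" if s: "0 < s" "s < \<sigma> t" for s t
  proof -
    obtain a where "a \<in> A t" "s < a" 
      using less_cSupE[OF s(2)[unfolded \<sigma>_def] A(1)] by blast
    then have "s \<le> a" "a \<le> 1" "len a \<le> t" using s by (auto simp: A_def)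
    then show ?thesis using mono[of s a] s by linarith
  qed
  have high: "t < len s" if "\<sigma> t < s" "s \<le> 1" for s t
  proof (rule ccontr)
    assume "\<not> t < len s"
    then have "s \<in> A t" using that \<sigma>01[of t] by (auto simp: A_def)
    then have "s \<le> \<sigma> t" unfolding \<sigma>_def using A by (intro cSup_upper)
    then show False using that by simp
  qed
  \<comment> \<open>\<open>low\<close> and \<open>high\<close> say nothing at
    \<open>\<sigma> t\<close> itself, so the value of \<open>\<gamma>\<close> there is approached
    through points shifted by \<open>c / Suc n\<close>.\<close>
  have lim: "(\<lambda>n. \<gamma> (s + c / Suc n)) \<longlonglongrightarrow> \<gamma> s"
    if "s \<in> {0..1}" "s + c \<in> {0..1}" for s c
  proof (rule continuous_on_tendsto_compose[OF cont])
    have "(\<lambda>n. s + c * (1 / Suc n)) \<longlonglongrightarrow> s + c * 0"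
      by (intro tendsto_intros LIMSEQ_Suc[OF lim_1_over_n])
    then show "(\<lambda>n. s + c / Suc n) \<longlonglongrightarrow> s" by simp
    have "s + c / Suc n \<in> {0..1}" for n
    proof -
      define q where "q = 1 / real (Suc n)"
      have "q \<in> {0..1}" by (simp add: q_def)
      then have "(1 - q) * s + q * (s + c) \<in> {0..1}"
        using convexD_alt[OF convex_real_interval(5) that, of q] by simp
      moreover have "(1 - q) * s + q * (s + c) = s + c * q" by (simp add: algebra_simps)
      ultimately show ?thesis by (simp add: q_def)
    qed
    then show "\<forall>\<^sub>F n in sequentially. s + c / Suc n \<in> {0..1}" by simp
  qed (use that in auto)
  have close: "dist (\<gamma> (\<sigma> s)) (\<gamma> (\<sigma> t)) \<le> t - s" if "s \<le> t" for s t
  proof (cases "\<sigma> s < \<sigma> t")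
    case False
    have "\<sigma> s \<le> \<sigma> t"
      unfolding \<sigma>_def using A that by (intro cSup_subset_mono) (auto simp: A_def)
    with False that show ?thesis by simp
  next
    case True
    \<comment> \<open>A third of the gap: each shifted point moves by at most \<open>c\<close>, so
      their order is kept.\<close>
    define c where "c = (\<sigma> t - \<sigma> s) / 3"
    have "3 * c = \<sigma> t - \<sigma> s" by (simp add: c_def)
    then have c: "0 < c" "\<sigma> s + 2 * c < \<sigma> t" using True by linarith+
    have "(\<lambda>n. dist (\<gamma> (\<sigma> s + c / Suc n)) (\<gamma> (\<sigma> t + (- c) / Suc n)))
        \<longlonglongrightarrow> dist (\<gamma> (\<sigma> s)) (\<gamma> (\<sigma> t))"
      using c \<sigma>01[of s] \<sigma>01[of t] by (intro tendsto_dist lim) auto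
    then show ?thesis
    proof (rule LIMSEQ_le_const2, intro exI[of _ 0] allI impI)
      fix n :: nat
      let ?a = "\<sigma> s + c / Suc n" and ?b = "\<sigma> t + (- c) / Suc n"
      have "0 < c / Suc n" "c / Suc n \<le> c" using c by (auto simp: field_simps)
      then have ab: "\<sigma> s < ?a" "?a \<le> ?b" "?b < \<sigma> t"
        using c by auto
      have "dist (\<gamma> ?a) (\<gamma> ?b) \<le> len ?b - len ?a"
        using ab \<sigma>01[of s] \<sigma>01[of t] by (intro chord) auto
      moreover have "len ?b \<le> t" using ab \<sigma>01[of s] by (intro low) auto
      moreover have "s < len ?a" using ab \<sigma>01[of t] by (intro high) auto
      ultimately show "dist (\<gamma> ?a) (\<gamma> ?b) \<le> t - s" by linarith
    qed
  qed
  show ?thesis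
  proof
    show "1-lipschitz_on {0..\<tau>} (\<lambda>t. \<gamma> (\<sigma> t))"
      by (rule lipschitz_on_leI) (use close in \<open>auto simp: dist_real_def\<close>)
    \<comment> \<open>If \<open>\<sigma> 0\<close> is positive, \<open>len\<close> is at most
      \<open>0\<close> strictly between \<open>0\<close> and \<open>\<sigma> 0\<close>, so all
      chords from \<open>0\<close> vanish there and continuity carries this to
      \<open>\<sigma> 0\<close>.\<close>
    have "\<gamma> (\<sigma> 0) = \<gamma> 0"
    proof (cases "\<sigma> 0 = 0")
      case False
      then have \<sigma>0: "0 < \<sigma> 0" using \<sigma>01[of 0] by simp
      have "\<gamma> (\<sigma> 0 + (- (\<sigma> 0 / 2)) / Suc n) = \<gamma> 0" for n
      proof -
        define p where "p = \<sigma> 0 / 2 / Suc n"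
        have "p \<le> \<sigma> 0 / 2" "0 < p" using \<sigma>0 by (auto simp: p_def field_simps)
        moreover have "(- (\<sigma> 0 / 2)) / Suc n = - p" by (simp add: p_def)
        ultimately have b: "0 < \<sigma> 0 + (- (\<sigma> 0 / 2)) / Suc n" "\<sigma> 0 + (- (\<sigma> 0 / 2)) / Suc n < \<sigma> 0"
          using \<sigma>0 by linarith+
        have "dist (\<gamma> 0) (\<gamma> (\<sigma> 0 + (- (\<sigma> 0 / 2)) / Suc n)) \<le> len (\<sigma> 0 + (- (\<sigma> 0 / 2)) / Suc n) - len 0"
          using b \<sigma>01[of 0] by (intro chord) auto
        also have "\<dots> \<le> 0" using low[OF b] len by simp
        finally show ?thesis by simp
      qed
      with lim[of "\<sigma> 0" "- (\<sigma> 0 / 2)"] \<sigma>01[of 0] show ?thesis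
        by (simp add: LIMSEQ_const_iff)
    qed simp
    then show "\<gamma> (\<sigma> 0) = \<gamma> 0" .
    have "1 \<in> A \<tau>" using len by (simp add: A_def)
    then have "1 \<le> \<sigma> \<tau>" unfolding \<sigma>_def using A by (intro cSup_upper)
    then show "\<gamma> (\<sigma> \<tau>) = \<gamma> 1" using \<sigma>01[of \<tau>] by (metis antisym)
  qed
qed

text \<open>The strict inequality yields a path of length below \<open>\<tau>\<close>, whose length
  function serves as \<open>len\<close> in the reparametrisation.\<close>

lemma length_space_lipschitz_curve:
  fixes y z :: "'a::metric_space"
  assumes "length_space TYPE('a)" "dist y z < \<tau>"
  obtains g where "1-lipschitz_on {0..\<tau>} g" "g 0 = y" "g \<tau> = z"
proof -
  have "(INF \<gamma> \<in> {\<gamma>. path \<gamma> \<and> pathstart \<gamma> = y \<and> pathfinish \<gamma> = z}. curve_length \<gamma> 0 1) < ereal \<tau>"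
    using assms unfolding length_space_def by (metis ereal_less_eq(3) not_le)
  then obtain \<gamma> where \<gamma>: "path \<gamma>" "pathstart \<gamma> = y" "pathfinish \<gamma> = z" "curve_length \<gamma> 0 1 < ereal \<tau>"
    unfolding INF_less_iff by blast
  \<comment> \<open>Finiteness matters because \<open>real_of_ereal\<close> sends infinity to
    \<open>0\<close>.\<close>
  have fin: "curve_length \<gamma> 0 t = ereal (real_of_ereal (curve_length \<gamma> 0 t))" if "0 \<le> t" "t \<le> 1" for t
  proof -
    have "curve_length \<gamma> 0 t + 0 \<le> curve_length \<gamma> 0 t + ereal (dist (\<gamma> t) (\<gamma> 1))"
      by (intro add_left_mono) simp
    also have "\<dots> \<le> curve_length \<gamma> 0 1" using that by (intro curve_length_superadditive)
    finally show ?thesis using \<gamma>(4) curve_length_nonneg[of \<gamma> 0 t]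
      by (cases "curve_length \<gamma> 0 t") auto
  qed
  show ?thesis
  proof (rule lipschitz_reparametrization[of \<gamma> "\<lambda>t. real_of_ereal (curve_length \<gamma> 0 t)" \<tau>])
    show "continuous_on {0..1} \<gamma>" using \<gamma> by (simp add: path_def)
    show "dist (\<gamma> s) (\<gamma> t) \<le> real_of_ereal (curve_length \<gamma> 0 t) - real_of_ereal (curve_length \<gamma> 0 s)"
      if "0 \<le> s" "s \<le> t" "t \<le> 1" for s t
      using curve_length_superadditive[OF that(1,2), of \<gamma>] fin[of s] fin[of t] that
      by (cases "curve_length \<gamma> 0 s"; cases "curve_length \<gamma> 0 t") auto
    show "0 \<le> real_of_ereal (curve_length \<gamma> 0 0)"
      by (simp add: real_of_ereal_pos curve_length_nonneg)
    show "real_of_ereal (curve_length \<gamma> 0 1) \<le> \<tau>"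
      using \<gamma>(4) fin[of 1] by (cases "curve_length \<gamma> 0 1") auto
    fix g assume "1-lipschitz_on {0..\<tau>} g" "g 0 = \<gamma> 0" "g \<tau> = \<gamma> 1"
    with \<gamma> that show thesis by (auto simp: pathstart_def pathfinish_def)
  qed
qed

text \<open>All connecting curves take the same time \<open>\<tau>\<close> and are laid end to end.
  Finitely many closed pieces cover a bounded time interval, and composing with the absolute value
  reaches negative times without raising the Lipschitz constant.\<close>

lemma lipschitz_curve_through_sequence:
  fixes x :: "nat \<Rightarrow> 'a::metric_space"
  assumes ls: "length_space TYPE('a)" and x: "\<And>i. dist (x i) (x (Suc i)) < \<tau>"
  obtains \<xi> where "1-lipschitz_on UNIV \<xi>" "\<And>i. \<xi> (real i * \<tau>) = x i" "\<And>t. \<xi> (- t) = \<xi> t"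
proof -
  have \<tau>: "\<tau> > 0" using x[of 0] zero_le_dist[of "x 0" "x (Suc 0)"] by linarith
  have "\<exists>g. 1-lipschitz_on {0..\<tau>} g \<and> g 0 = x i \<and> g \<tau> = x (Suc i)" for i
    using length_space_lipschitz_curve[OF ls x] by metis
  then obtain g where g: "\<And>i. 1-lipschitz_on {0..\<tau>} (g i)" "\<And>i. g i 0 = x i"
    "\<And>i. g i \<tau> = x (Suc i)" by metis
  define h where "h t = g (nat \<lfloor>t / \<tau>\<rfloor>) (t - of_int \<lfloor>t / \<tau>\<rfloor> * \<tau>)" for t
  \<comment> \<open>At a right end point the floor selects piece \<open>Suc i\<close>; it agrees
    with the end of piece \<open>i\<close>, both being \<open>x (Suc i)\<close>.\<close>
  have h: "h t = g i (t - real i * \<tau>)" if "t \<in> {real i * \<tau>..real (Suc i) * \<tau>}" for t i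
  proof (cases "t = real (Suc i) * \<tau>")
    case True
    then have "t / \<tau> = of_nat (Suc i)" using \<tau> by simp
    then have "\<lfloor>t / \<tau>\<rfloor> = int (Suc i)" by (metis floor_of_nat)
    then have "h t = x (Suc i)" using True g(2) by (simp add: h_def nat_add_distrib)
    moreover have "t - real i * \<tau> = \<tau>" using True by (simp add: algebra_simps)
    ultimately show ?thesis using g(3) by simp
  next
    case False
    with that have "real i \<le> t / \<tau>" "t / \<tau> < real i + 1" using \<tau> by (auto simp: field_simps)
    then have "\<lfloor>t / \<tau>\<rfloor> = int i" by (intro floor_unique) auto
    then show ?thesis by (simp add: h_def)
  qed
  have h_piece: "1-lipschitz_on {real i * \<tau>..real (Suc i) * \<tau>} h" for i
  proof (rule lipschitz_onI)
    fix s t assume st: "s \<in> {real i * \<tau>..real (Suc i) * \<tau>}" "t \<in> {real i * \<tau>..real (Suc i) * \<tau>}"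
    have "dist (g i (s - real i * \<tau>)) (g i (t - real i * \<tau>)) \<le> 1 * dist (s - real i * \<tau>) (t - real i * \<tau>)"
      using st by (intro lipschitz_onD[OF g(1)]) (auto simp: algebra_simps)
    then show "dist (h s) (h t) \<le> 1 * dist s t"
      unfolding h[OF st(1)] h[OF st(2)] by (simp add: dist_real_def)
  qed simp
  have h_lip: "dist (h s) (h t) \<le> dist s t" if "0 \<le> s" "0 \<le> t" for s t
  proof -
    obtain N :: nat where N: "max s t / \<tau> < real N" using reals_Archimedean2 by blast
    have "1-lipschitz_on {0..max s t} h"
    proof (rule lipschitz_on_closed_Union[of "{..N}" _ "\<lambda>i. {real i * \<tau>..real (Suc i) * \<tau>}"])
      show "{0..max s t} \<subseteq> (\<Union>i\<in>{..N}. {real i * \<tau>..real (Suc i) * \<tau>})"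
      proof
        fix r assume r: "r \<in> {0..max s t}"
        then have "0 \<le> r / \<tau>" "r / \<tau> \<le> max s t / \<tau>" using \<tau> by (auto intro: divide_right_mono)
        define i where "i = nat \<lfloor>r / \<tau>\<rfloor>"
        have i: "real i \<le> r / \<tau>" "r / \<tau> < real (Suc i)"
          using \<open>0 \<le> r / \<tau>\<close> unfolding i_def by linarith+
        then have "i \<le> N" using N \<open>r / \<tau> \<le> max s t / \<tau>\<close> by linarith
        with i \<tau> show "r \<in> (\<Union>i\<in>{..N}. {real i * \<tau>..real (Suc i) * \<tau>})"
          by (intro UN_I[of i]) (auto simp: field_simps)
      qed
    qed (use h_piece in auto)
    from lipschitz_onD[OF this, of s t] show ?thesis using that by auto
  qed
  show ?thesis
  proof
    show "1-lipschitz_on UNIV (\<lambda>t. h \<bar>t\<bar>)"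
    proof (rule lipschitz_onI)
      fix s t :: real
      have "dist (h \<bar>s\<bar>) (h \<bar>t\<bar>) \<le> dist \<bar>s\<bar> \<bar>t\<bar>" by (intro h_lip) auto
      also have "\<dots> \<le> dist s t" by (simp add: dist_real_def)
      finally show "dist (h \<bar>s\<bar>) (h \<bar>t\<bar>) \<le> 1 * dist s t" by simp
    qed simp
    show "h \<bar>real i * \<tau>\<bar> = x i" for i
    proof -
      have "h (real i * \<tau>) = g i (real i * \<tau> - real i * \<tau>)"
        by (rule h) (use \<tau> in \<open>auto simp: algebra_simps\<close>)
      then show ?thesis using g(2) \<tau> by simp
    qed
  qed simp
qed

section \<open>Exit intervals and the supersolution property\<close>

lemma open_exit_interval: "open (exit_interval U \<xi>)"
  unfolding exit_interval_def Collect_conj_eq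
  by (intro open_Int open_Collect_less continuous_intros)

text \<open>A point \<open>s\<close> between \<open>0\<close> and \<open>t\<close> with
  \<open>\<xi> s\<close> outside \<open>U\<close> would bound the exit time on that side, placing
  \<open>t\<close> at or beyond it.\<close>

lemma exit_interval_inside:
  assumes "t \<in> exit_interval U \<xi>" "0 \<le> s \<and> s \<le> t \<or> t \<le> s \<and> s \<le> 0"
  shows "\<xi> s \<in> U"
proof (rule ccontr)
  assume s: "\<xi> s \<notin> U"
  show False
  proof (cases "0 \<le> s \<and> s \<le> t")
    case True
    then have "exit_time_plus U \<xi> \<le> ereal s"
      unfolding exit_time_plus_def using s by (intro Inf_lower) auto
    also have "\<dots> \<le> ereal t" using True by simp
    finally show False using assms(1) by (auto simp: exit_interval_def dest: leD)
  next
    case False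
    with assms(2) have st: "t \<le> s" "s \<le> 0" by auto
    then have "ereal t \<le> ereal s" by simp
    also have "\<dots> \<le> exit_time_minus U \<xi>"
      unfolding exit_time_minus_def using s st by (intro Sup_upper) auto
    finally show False using assms(1) by (auto simp: exit_interval_def dest: leD)
  qed
qed

text \<open>The error \<open>e\<close> is spent in quarters: one for the variation of
  \<open>f\<close> on \<open>cball y \<rho>\<close>, one for charging a drop over distance
  \<open>\<rho>\<close> to the longer time \<open>\<tau>\<close>, and one for the variation of
  \<open>f\<close> between a node and the curve.\<close>

lemma monge_solution_local_c_supersolution:
  fixes \<Omega> :: "'a::complete_space set"
  assumes ls: "length_space TYPE('a)" and f: "locally_uniformly_continuous_on \<Omega> f"
    and pos: "\<forall>x\<in>\<Omega>. f x > 0" and u: "monge_solution \<Omega> f u"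
    and cont: "continuous_on \<Omega> u"
  shows "local_c_supersolution \<Omega> f u"
  unfolding local_c_supersolution_def Let_def
proof (intro conjI ballI)
  show "lsc_on \<Omega> u"
    using cont by (auto simp: lsc_on_def continuous_on_def order_tendstoD)
next
  fix x assume x: "x \<in> \<Omega>"
  define F where "F = f x"
  have F: "F > 0" using pos x by (simp add: F_def)
  obtain r1 where r1: "r1 > 0" "ball x r1 \<subseteq> \<Omega>" "uniformly_continuous_on (ball x r1) f"
    using f x unfolding locally_uniformly_continuous_on_def by blast
  obtain r2 L where r2: "r2 > 0" "L-lipschitz_on (ball x r2) u"
    using u x unfolding monge_solution_def locally_lipschitz_on_def by blast
  obtain r3 where r3: "r3 > 0" "\<And>y. y \<in> ball x r1 \<Longrightarrow> dist y x < r3 \<Longrightarrow> dist (f y) (f x) < F / 2"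
    using uniformly_continuous_onE[OF r1(3), of "F / 2"] F r1(1)
    by (metis centre_in_ball dist_commute half_gt_zero)
  \<comment> \<open>On \<open>ball x R\<close>, \<open>u\<close> is Lipschitz, \<open>f\<close> is
    uniformly continuous, and \<open>f\<close> lies between \<open>F / 2\<close> and
    \<open>2 * F\<close>.\<close>
  define R where "R = min r1 (min r2 r3)"
  have R: "R > 0" using r1 r2 r3 by (simp add: R_def)
  have R\<Omega>: "ball x R \<subseteq> \<Omega>" using r1 by (auto simp: R_def)
  have lip: "L-lipschitz_on (ball x R) u"
    by (rule lipschitz_on_subset[OF r2(2)]) (auto simp: R_def)
  have L: "0 \<le> L" using lip by (rule lipschitz_on_nonneg)
  have "ball x R \<subseteq> ball x r1" by (auto simp: R_def)
  with r1(3) have uc: "uniformly_continuous_on (ball x R) f"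
    unfolding uniformly_continuous_on_def by (meson subsetD)
  have fF: "F / 2 < f y" "f y < 2 * F" if "y \<in> ball x R" for y
  proof -
    have "dist (f y) (f x) < F / 2"
      using that by (intro r3(2)) (auto simp: R_def dist_commute)
    then show "F / 2 < f y" "f y < 2 * F" using F by (auto simp: F_def dist_real_def abs_if split: if_splits)
  qed
  \<comment> \<open>The margin \<open>R / 2\<close> exceeds \<open>\<tau>\<close>, so balls of
    radius \<open>\<rho>\<close> about points of \<open>ball x r\<close> stay in
    \<open>ball x R\<close>.\<close>
  define r where "r = R / 2"
  have rR: "ball x r \<subseteq> ball x R" using R by (auto simp: r_def)
  show "\<exists>r>0. ball x r \<subseteq> \<Omega> \<and>
        (\<forall>\<epsilon>>0. \<exists>\<xi>\<in>admissible_curves x UNIV. \<exists>w :: real \<Rightarrow> real.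
             lsc_on (exit_interval (ball x r) \<xi>) w \<and>
             w 0 = u x \<and>
             (\<forall>t\<in>exit_interval (ball x r) \<xi>. u (\<xi> t) - \<epsilon> \<le> w t) \<and>
             (\<forall>\<phi>. \<phi> C1_differentiable_on UNIV \<longrightarrow>
                (\<forall>t\<^sub>0\<in>exit_interval (ball x r) \<xi>.
                   (\<forall>t\<in>exit_interval (ball x r) \<xi>. w t\<^sub>0 - \<phi> t\<^sub>0 \<le> w t - \<phi> t) \<longrightarrow>
                   f (\<xi> t\<^sub>0) - \<epsilon> \<le> \<bar>deriv \<phi> t\<^sub>0\<bar>)))"
    (is "\<exists>r>0. _ \<and> (\<forall>\<epsilon>>0. ?P r \<epsilon>)")
  proof (intro exI[of _ r] conjI allI impI)
    show "0 < r" using R by (simp add: r_def)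
    show "ball x r \<subseteq> \<Omega>" using rR R\<Omega> by blast
  next
    fix \<epsilon> :: real assume \<epsilon>: "\<epsilon> > 0"
    \<comment> \<open>Capping by \<open>F\<close> keeps the rates \<open>f y - e / 4\<close> and
      \<open>f y - e / 2\<close> positive on \<open>ball x R\<close>.\<close>
    define e where "e = min \<epsilon> F"
    have e: "0 < e" "e \<le> \<epsilon>" "e \<le> F" using \<epsilon> F by (auto simp: e_def)
    obtain \<delta> where \<delta>: "\<delta> > 0"
      "\<And>y z. y \<in> ball x R \<Longrightarrow> z \<in> ball x R \<Longrightarrow> dist z y < \<delta> \<Longrightarrow> \<bar>f z - f y\<bar> < e / 4"
      using uc e unfolding uniformly_continuous_on_def dist_real_def
      by (metis zero_less_divide_iff zero_less_numeral)
    \<comment> \<open>Chosen so that \<open>\<eta> * (2 * F) = e / 4\<close>.\<close>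
    define \<eta> where "\<eta> = e / (8 * F)"
    have \<eta>: "\<eta> > 0" using e F by (simp add: \<eta>_def)
    \<comment> \<open>The three bounds keep a step inside \<open>ball x R\<close>, keep
      \<open>f\<close> within \<open>e / 4\<close> during a step, and keep the combined change of
      \<open>u\<close> and \<open>w\<close> in a step below \<open>\<epsilon>\<close>.\<close>
    define \<tau> where "\<tau> = min (R / 4) (min (\<delta> / 2) (\<epsilon> / (L + 2 * F)))"
    have \<tau>: "0 < \<tau>" "\<tau> < R / 2" "\<tau> < \<delta>" "\<tau> \<le> \<epsilon> / (L + 2 * F)"
      using R \<delta> \<epsilon> L F by (auto simp: \<tau>_def)
    have "(L + 2 * F) * \<tau> \<le> \<epsilon>" using \<tau>(4) L F by (simp add: field_simps)
    then have \<tau>\<epsilon>: "L * \<tau> + 2 * F * \<tau> \<le> \<epsilon>" by (simp add: algebra_simps)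
    \<comment> \<open>The gap between \<open>\<rho>\<close> and \<open>\<tau>\<close> is needed
      since points at distance \<open>\<rho>\<close> may be joined only by curves longer than
      \<open>\<rho>\<close>.\<close>
    define \<rho> where "\<rho> = \<tau> / (1 + \<eta>)"
    have \<tau>\<rho>: "\<tau> = \<rho> * (1 + \<eta>)" using \<eta> by (simp add: \<rho>_def)
    have \<rho>: "0 < \<rho>" "\<rho> < \<tau>" using \<tau> \<eta> by (auto simp: \<rho>_def field_simps)

    \<comment> \<open>Outside \<open>ball x r\<close> only the distance bound is demanded, and
      \<open>y\<close> itself serves; this makes the successor map total.\<close>
    have "\<exists>z. dist y z < \<tau> \<and> (y \<in> ball x r \<longrightarrow> u z \<le> u y - (f y - e / 2) * \<tau>)" for y
    proof (cases "y \<in> ball x r")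
      case True
      then have yR: "y \<in> ball x R" using rR by blast
      have sub: "cball y \<rho> \<subseteq> ball x R"
      proof
        fix z assume "z \<in> cball y \<rho>"
        then show "z \<in> ball x R"
          using True \<rho> \<tau> dist_triangle[of x z y] by (simp add: r_def)
      qed
      have "f y - e / 4 > 0" using fF[OF yR] e by simp
      moreover have "ereal (f y - e / 4) < subslope \<Omega> u z" if "z \<in> cball y \<rho>" for z
      proof -
        have "\<bar>f z - f y\<bar> < e / 4"
          by (rule \<delta>(2)) (use that yR sub \<rho> \<tau> in \<open>auto simp: dist_commute\<close>)
        then have "f y - e / 4 < f z" by linarith
        moreover have "z \<in> ball x R" using that sub by blast
        ultimately show ?thesis using u R\<Omega> by (auto simp: monge_solution_def subset_eq)
      qed
      ultimately obtain z where z: "dist y z = \<rho>" "u z \<le> u y - (f y - e / 4) * \<rho>"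
        using slope_sphere_descent[OF lipschitz_on_subset[OF lip sub], of "f y - e / 4" \<Omega>] \<rho>(1)
        by blast
      have "\<eta> * (f y - e / 2) \<le> \<eta> * (2 * F)"
        using fF[OF yR] \<eta> e by (intro mult_left_mono) auto
      also have "\<dots> = e / 4" using F by (simp add: \<eta>_def)
      finally have "(f y - e / 2) * (1 + \<eta>) \<le> f y - e / 4" by (simp add: algebra_simps)
      then have "\<rho> * ((f y - e / 2) * (1 + \<eta>)) \<le> \<rho> * (f y - e / 4)"
        using \<rho> by (intro mult_left_mono) auto
      then have "(f y - e / 2) * \<tau> \<le> (f y - e / 4) * \<rho>"
        unfolding \<tau>\<rho> by (simp add: algebra_simps)
      with z \<rho> show ?thesis by (intro exI[of _ z]) auto
    next
      case False
      then show ?thesis using \<tau> by (intro exI[of _ y]) auto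
    qed
    then obtain nxt where nxt: "\<And>y. dist y (nxt y) < \<tau>"
      "\<And>y. y \<in> ball x r \<Longrightarrow> u (nxt y) \<le> u y - (f y - e / 2) * \<tau>" by metis
    define X where "X = rec_nat x (\<lambda>_. nxt)"
    have X: "X 0 = x" "X (Suc i) = nxt (X i)" for i by (simp_all add: X_def)
    have X_drop: "u (X (Suc i)) \<le> u (X i) - (f (X i) - e / 2) * \<tau>" if "X i \<in> ball x r" for i
      using nxt(2)[OF that] by (simp add: X)
    have "dist (X i) (X (Suc i)) < \<tau>" for i using nxt(1) by (simp add: X)
    from lipschitz_curve_through_sequence[of X \<tau>, OF ls this]
    obtain \<xi> where \<xi>: "1-lipschitz_on UNIV \<xi>" "\<And>i. \<xi> (real i * \<tau>) = X i" "\<And>t. \<xi> (- t) = \<xi> t"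
      by metis
    have \<xi>_abs: "\<xi> \<bar>t\<bar> = \<xi> t" for t using \<xi>(3)[of t] by (simp add: abs_if)
    define I where "I = exit_interval (ball x r) \<xi>"
    \<comment> \<open>\<open>\<xi>\<close> is even, so containment in the ball on one side of
      \<open>0\<close> carries over to the other.\<close>
    have I: "\<xi> s \<in> ball x r" if "t \<in> I" "\<bar>s\<bar> \<le> \<bar>t\<bar>" for s t
    proof (cases "0 \<le> t")
      case True
      have "\<xi> \<bar>s\<bar> \<in> ball x r"
        by (rule exit_interval_inside[of t]) (use that True in \<open>auto simp: I_def\<close>)
      then show ?thesis by (simp only: \<xi>_abs)
    next
      case False
      have "\<xi> (- \<bar>s\<bar>) \<in> ball x r"
        by (rule exit_interval_inside[of t]) (use that False in \<open>auto simp: I_def\<close>)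
      then show ?thesis by (simp only: \<xi>_abs \<xi>(3))
    qed

    define idx where "idx t = nat \<lfloor>\<bar>t\<bar> / \<tau>\<rfloor>" for t :: real
    have idx: "real (idx t) * \<tau> \<le> \<bar>t\<bar>" "\<bar>t\<bar> < (real (idx t) + 1) * \<tau>" for t
    proof -
      have "0 \<le> \<bar>t\<bar> / \<tau>" using \<tau> by simp
      then have "real (idx t) \<le> \<bar>t\<bar> / \<tau>" "\<bar>t\<bar> / \<tau> < real (idx t) + 1"
        unfolding idx_def by linarith+
      then show "real (idx t) * \<tau> \<le> \<bar>t\<bar>" "\<bar>t\<bar> < (real (idx t) + 1) * \<tau>"
        using \<tau>(1) by (simp_all add: field_simps)
    qed
    have idx_eq: "idx t = i" if "real i * \<tau> \<le> \<bar>t\<bar>" "\<bar>t\<bar> < (real i + 1) * \<tau>" for t i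
    proof -
      have "real i \<le> \<bar>t\<bar> / \<tau>" "\<bar>t\<bar> / \<tau> < real i + 1"
        using that \<tau>(1) by (simp_all add: field_simps)
      then have "\<lfloor>\<bar>t\<bar> / \<tau>\<rfloor> = int i" by (intro floor_unique) auto
      then show ?thesis by (simp add: idx_def)
    qed
    \<comment> \<open>\<open>w\<close> is affine in \<open>|t|\<close> between the nodes and may only jump down at a node, so it is lower
      semicontinuous; restarting from \<open>u (X i)\<close> keeps the error from accumulating.\<close>
    define c where "c i = f (X i) - e / 2" for i
    define w where "w t = u (X (idx t)) - c (idx t) * (\<bar>t\<bar> - real (idx t) * \<tau>)" for t
    \<comment> \<open>Node \<open>idx t\<close> is visited no later than
      \<open>\<bar>t\<bar>\<close>, hence before the exit, even if the next node lies outside the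
      ball.\<close>
    have X_in: "X (idx t) \<in> ball x r" if "t \<in> I" for t
      using I[OF that, of "real (idx t) * \<tau>"] idx(1)[of t] \<tau>(1) \<xi>(2) by (simp add: abs_mult)
    have c: "0 \<le> c i" "c i \<le> 2 * F" if "X i \<in> ball x r" for i
    proof -
      have "X i \<in> ball x R" using that rR by blast
      from fF[OF this] e show "0 \<le> c i" "c i \<le> 2 * F" by (auto simp: c_def)
    qed
    have \<xi>_close: "dist (\<xi> t) (X (idx t)) < \<tau>" for t
    proof -
      have "dist (\<xi> \<bar>t\<bar>) (\<xi> (real (idx t) * \<tau>)) \<le> 1 * dist \<bar>t\<bar> (real (idx t) * \<tau>)"
        by (rule lipschitz_onD[OF \<xi>(1)]) auto
      also have "\<dots> < \<tau>" using idx[of t] by (simp add: dist_real_def algebra_simps)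
      finally show ?thesis by (simp only: \<xi>_abs \<xi>(2))
    qed
    have in_R: "\<xi> t \<in> ball x R" "X (idx t) \<in> ball x R" if "t \<in> I" for t
      using I[OF that order_refl] X_in[OF that] rR by blast+

    show "?P r \<epsilon>"
    proof (intro bexI[of _ \<xi>] exI[of _ w], fold I_def, intro conjI ballI allI impI)
      show "\<xi> \<in> admissible_curves x UNIV"
        using \<xi>(1) \<xi>(2)[of 0] by (simp add: admissible_curves_def X)
      have "idx 0 = 0" by (simp add: idx_def)
      then show "w 0 = u x" by (simp add: w_def X)
    next
      fix t assume t: "t \<in> I"
      have "dist (u (\<xi> t)) (u (X (idx t))) \<le> L * dist (\<xi> t) (X (idx t))"
        using in_R[OF t] by (intro lipschitz_onD[OF lip])
      also have "\<dots> \<le> L * \<tau>" using \<xi>_close[of t] L by (intro mult_left_mono) auto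
      finally have "u (\<xi> t) \<le> u (X (idx t)) + L * \<tau>" by (simp add: dist_real_def)
      moreover have "c (idx t) * (\<bar>t\<bar> - real (idx t) * \<tau>) \<le> (2 * F) * \<tau>"
        using idx[of t] c[OF X_in[OF t]] F by (intro mult_mono) (auto simp: algebra_simps)
      ultimately show "u (\<xi> t) - \<epsilon> \<le> w t" using \<tau>\<epsilon> by (simp add: w_def)
    next
      show "lsc_on I w"
        unfolding lsc_on_def
      proof (intro ballI allI impI)
        fix t0 a assume t0: "t0 \<in> I" and a: "a < w t0"
        \<comment> \<open>The bounds ensure that at most one node is crossed backwards, that the
          next node is not reached, and that an affine piece of slope at most \<open>2 * F\<close>
          changes by less than \<open>w t0 - a\<close>.\<close>
        define d where "d = min (min \<tau> ((real (idx t0) + 1) * \<tau> - \<bar>t0\<bar>)) ((w t0 - a) / (2 * F))"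
        have d: "d > 0" using \<tau> idx(2)[of t0] a F by (simp add: d_def)
        have "a < w t" if t: "t \<in> I" "\<bar>t - t0\<bar> < d" for t
        proof (cases "real (idx t0) * \<tau> \<le> \<bar>t\<bar>")
          case True
          have "idx t = idx t0"
            using True t(2) by (intro idx_eq) (auto simp: d_def)
          then have "w t0 - w t = c (idx t0) * (\<bar>t\<bar> - \<bar>t0\<bar>)" by (simp add: w_def algebra_simps)
          also have "\<dots> \<le> c (idx t0) * \<bar>t - t0\<bar>"
            using c(1)[OF X_in[OF t0]] by (intro mult_left_mono) auto
          also have "\<dots> \<le> (2 * F) * \<bar>t - t0\<bar>"
            using c(2)[OF X_in[OF t0]] by (intro mult_right_mono) auto
          also have "\<dots> < w t0 - a" using t(2) F by (simp add: d_def field_simps)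
          finally show ?thesis by simp
        next
          \<comment> \<open>Here \<open>t\<close> belongs to the step just before that of
            \<open>t0\<close>; \<open>X_drop\<close> shows that the value of \<open>w\<close> at the
            node is at most every value taken on that earlier step.\<close>
          case False
          then have lt: "real (idx t) * \<tau> < real (idx t0) * \<tau>" using idx(1)[of t] by linarith
          have "\<bar>t - t0\<bar> < \<tau>" using t(2) by (simp add: d_def)
          then have "real (idx t0) * \<tau> < (real (idx t) + 2) * \<tau>"
            using idx(1)[of t0] idx(2)[of t] by (simp add: algebra_simps)
          with lt have "real (idx t) < real (idx t0)" "real (idx t0) < real (idx t) + 2"
            using \<tau>(1) by simp_all
          then have *: "Suc (idx t) = idx t0" by linarith
          have "a < w t0" by fact
          also have "w t0 \<le> u (X (idx t0))"
            using c(1)[OF X_in[OF t0]] idx(1)[of t0] by (simp add: w_def)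
          also have "\<dots> \<le> u (X (idx t)) - c (idx t) * \<tau>"
            using X_drop[OF X_in[OF t(1)]] by (simp add: * c_def)
          also have "\<dots> \<le> w t"
            unfolding w_def using c(1)[OF X_in[OF t(1)]] idx(2)[of t]
            by (intro diff_left_mono mult_left_mono) (auto simp: algebra_simps)
          finally show ?thesis .
        qed
        then show "\<forall>\<^sub>F t in at t0 within I. a < w t"
          unfolding eventually_at using d by (auto simp: dist_real_def)
      qed
    next
      fix \<phi> t0 assume \<phi>: "\<phi> C1_differentiable_on UNIV" and t0: "t0 \<in> I"
        and mn: "\<forall>t\<in>I. w t0 - \<phi> t0 \<le> w t - \<phi> t"
      \<comment> \<open>Testing only in the direction away from \<open>0\<close> suffices, where \<open>w\<close> is affine.\<close>
      define s :: real where "s = (if 0 \<le> t0 then 1 else -1)"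
      have s: "\<bar>t0 + s * h\<bar> = \<bar>t0\<bar> + h" "\<bar>s * h\<bar> = h" if "h > 0" for h
        using that by (auto simp: s_def)
      obtain b where b: "b > 0" "\<And>t. \<bar>t - t0\<bar> < b \<Longrightarrow> t \<in> I"
        using open_exit_interval[of "ball x r" \<xi>] t0 unfolding I_def open_dist dist_real_def by blast
      \<comment> \<open>\<open>b\<close> keeps the shifted point in \<open>I\<close>; the second
        bound keeps it before the next node, so \<open>w\<close> is affine in
        \<open>h\<close>.\<close>
      define b' where "b' = min b ((real (idx t0) + 1) * \<tau> - \<bar>t0\<bar>)"
      have "b' > 0" using b(1) idx(2)[of t0] by (simp add: b'_def)
      then have "\<forall>\<^sub>F h in at_right 0. h \<in> {0<..<b'}" by (rule eventually_at_right_real)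
      then have "\<forall>\<^sub>F h in at_right 0. \<phi> (t0 + s * h) - \<phi> t0 \<le> (- c (idx t0)) * h"
      proof eventually_elim
        case (elim h)
        then have h: "0 < h" "h < b" "h < (real (idx t0) + 1) * \<tau> - \<bar>t0\<bar>" by (auto simp: b'_def)
        have "idx (t0 + s * h) = idx t0"
          using h s[OF h(1)] idx(1)[of t0] by (intro idx_eq) auto
        then have "w (t0 + s * h) = w t0 - c (idx t0) * h"
          using s[OF h(1)] by (simp add: w_def algebra_simps)
        moreover have "t0 + s * h \<in> I" using s[OF h(1)] h by (intro b(2)) simp
        ultimately show ?case using mn by force
      qed
      then have "s * deriv \<phi> t0 \<le> - c (idx t0)"
        by (rule has_real_derivative_one_sided_le[OF C1_differentiable_on_imp_DERIV[OF \<phi>]])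
      then have "c (idx t0) \<le> \<bar>deriv \<phi> t0\<bar>" by (auto simp: s_def split: if_splits)
      moreover have "\<bar>f (\<xi> t0) - f (X (idx t0))\<bar> < e / 4"
        using in_R[OF t0] \<xi>_close[of t0] \<tau>(3) by (intro \<delta>(2)) auto
      ultimately show "f (\<xi> t0) - \<epsilon> \<le> \<bar>deriv \<phi> t0\<bar>" using e unfolding c_def by linarith
    qed
  qed
qed

theorem proposition4p8:
  fixes \<Omega> :: "'a::complete_space set" and f u :: "'a \<Rightarrow> real"
  assumes "length_space TYPE('a)"
    and "open \<Omega>"
    and "locally_uniformly_continuous_on \<Omega> f"
    and "\<forall>x\<in>\<Omega>. f x > 0"
    and "monge_solution \<Omega> f u"
  shows "local_c_solution \<Omega> f u"
proof -
  have "continuous (at x) u" if "x \<in> \<Omega>" for x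
  proof -
    obtain r L where "r > 0" "L-lipschitz_on (ball x r) u"
      using assms(5) \<open>x \<in> \<Omega>\<close> unfolding monge_solution_def locally_lipschitz_on_def by blast
    then show ?thesis
      using lipschitz_on_continuous_on continuous_on_interior[of "ball x r" u x] by fastforce
  qed
  then have "continuous_on \<Omega> u" by (simp add: continuous_at_imp_continuous_on)
  then show ?thesis
    unfolding local_c_solution_def
    using monge_solution_c_subsolution[OF assms(4,5)]
      monge_solution_local_c_supersolution[OF assms(1,3,4,5)] by blast
qed

end
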